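(* The groups $\Lambda_{k,i}$, $k\in\mathbb N$, $i\in\{0,\pi/2,\pi\}$, are pairwise not isomorphic; that is, if $k,p\in\mathbb N$ and $i,j\in\{0,\pi/2,\pi\}$ with $(k,i)\ne(p,j)$, then $\Lambda_{k,i}$ and $\Lambda_{p,j}$ are not isomorphic as groups.
   Context: $\mathbb N$ denotes the positive integers. The oscillator group $G=\mathbb R\ltimes_\alpha \mathrm H_3(\mathbb R)$ is $\mathbb R^4$ with coordinates $(t,x,y,z)$ and product $$(t,x,y,z)(t',x',y',z')=\bigl(t+t',\;x+u,\;y+v,\;z+z'+\tfrac12(xv-uy)\bigr),$$ where $u=x'\cos t+y'\sin t$ and $v=-x'\sin t+y'\cos t$. For $k\in\mathbb N$ put $\Gamma_k=\mathbb Z\times\mathbb Z\times\frac1{2k}\mathbb Z$ and define the subgroups of $G$ $$\Lambda_{k,0}=2\pi\mathbb Z\times\Gamma_k,\qquad \Lambda_{k,\pi}=\pi\mathbb Z\times\Gamma_k,\qquad \Lambda_{k,\pi/2}=\tfrac{\pi}{2}\mathbb Z\times\Gamma_k$$ (as subsets of $\mathbb R\times\mathbb R^3$, with the product of $G$). *)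

theory Defs
  imports "HOL-Algebra.Group" Complex_Main
begin

type_synonym real4 = "real \<times> real \<times> real \<times> real"

fun osc_mult :: "real4 \<Rightarrow> real4 \<Rightarrow> real4" where
  "osc_mult (t, x, y, z) (t', x', y', z') =
     (let u = x' * cos t + y' * sin t;
          v = - x' * sin t + y' * cos t
      in (t + t', x + u, y + v, z + z' + 1/2 * (x * v - u * y)))"

definition oscillator_group :: "real4 monoid" where
  "oscillator_group = \<lparr>carrier = UNIV, mult = osc_mult, one = (0, 0, 0, 0)\<rparr>"

definition multiples :: "real \<Rightarrow> real set" where
  "multiples c = range (\<lambda>n::int. c * of_int n)"

definition Gamma :: "nat \<Rightarrow> (real \<times> real \<times> real) set" where
  "Gamma k = \<int> \<times> \<int> \<times> multiples (1 / (2 * real k))"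

text \<open>The index \<open>i\<close> is an angle modulo \<open>2 * pi\<close>; it ranges over \<open>{0, pi/2, pi}\<close>, and the
  index \<open>0\<close> stands for the time lattice generated by \<open>2 * pi\<close>. Outside these indices and for
  \<open>k = 0\<close> the set below carries no meaning.\<close>

definition Lambda :: "nat \<Rightarrow> real \<Rightarrow> real4 set" where
  "Lambda k i = multiples (if i = 0 then 2 * pi else i) \<times> Gamma k"

definition Lambda_group :: "nat \<Rightarrow> real \<Rightarrow> real4 monoid" where
  "Lambda_group k i = oscillator_group\<lparr>carrier := Lambda k i\<rparr>"

lemma osc_mult_assoc: "osc_mult (osc_mult a b) c = osc_mult a (osc_mult b c)"
proof -
  obtain t x y z where a: "a = (t, x, y, z)" by (metis prod.exhaust)
  obtain t' x' y' z' where b: "b = (t', x', y', z')" by (metis prod.exhaust)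
  obtain t'' x'' y'' z'' where c: "c = (t'', x'', y'', z'')" by (metis prod.exhaust)
  have z: "z + z' + 1/2 * (x * (- x' * S + y' * C) - (x' * C + y' * S) * y) + z''
      + 1/2 * ((x + (x' * C + y' * S)) * (- x'' * (S * C' + C * S') + y'' * (C * C' - S * S'))
             - (x'' * (C * C' - S * S') + y'' * (S * C' + C * S')) * (y + (- x' * S + y' * C)))
    = z + (z' + z'' + 1/2 * (x' * (- x'' * S' + y'' * C') - (x'' * C' + y'' * S') * y'))
      + 1/2 * (x * (- (x' + (x'' * C' + y'' * S')) * S + (y' + (- x'' * S' + y'' * C')) * C)
             - ((x' + (x'' * C' + y'' * S')) * C + (y' + (- x'' * S' + y'' * C')) * S) * y)"
    if "C\<^sup>2 + S\<^sup>2 = 1" for C S C' S' :: real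
    using that by algebra
  show ?thesis
    unfolding a b c osc_mult.simps Let_def prod.inject cos_add sin_add
    using z[OF sin_cos_squared_add2[of t], of "cos t'" "sin t'"]
    by (auto simp: algebra_simps)
qed

definition osc_inv :: "real4 \<Rightarrow> real4" where
  "osc_inv = (\<lambda>(t, x, y, z). (- t, - x * cos t + y * sin t, - x * sin t - y * cos t, - z))"

lemma osc_inv_left: "osc_mult (osc_inv a) a = (0, 0, 0, 0)"
  by (cases a) (simp add: osc_inv_def Let_def field_simps)

lemma group_oscillator_group: "group oscillator_group"
proof (rule groupI)
  show "\<exists>y\<in>carrier oscillator_group. y \<otimes>\<^bsub>oscillator_group\<^esub> x = \<one>\<^bsub>oscillator_group\<^esub>" for x
    using osc_inv_left[of x] by (intro bexI[of _ "osc_inv x"]) (simp_all add: oscillator_group_def)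
qed (auto simp: oscillator_group_def osc_mult_assoc)

lemma inv_oscillator_group: "inv\<^bsub>oscillator_group\<^esub> a = osc_inv a"
  using group.inv_equality[OF group_oscillator_group, of "osc_inv a" a] osc_inv_left[of a]
  by (simp add: oscillator_group_def)

lemma multiples_add: "a \<in> multiples c \<Longrightarrow> b \<in> multiples c \<Longrightarrow> a + b \<in> multiples c"
  unfolding multiples_def by (auto simp flip: distrib_left of_int_add)

lemma multiples_uminus: "a \<in> multiples c \<Longrightarrow> - a \<in> multiples c"
  unfolding multiples_def by (auto simp flip: mult_minus_right of_int_minus)

lemma half_Int_in_multiples:
  assumes "k > 0" "a \<in> \<int>" shows "1/2 * a \<in> multiples (1 / (2 * real k))"
proof -
  from \<open>a \<in> \<int>\<close> obtain n where "a = of_int n" by (auto elim: Ints_cases)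
  then have "1/2 * a = 1 / (2 * real k) * of_int (n * int k)" using assms by simp
  then show ?thesis unfolding multiples_def by blast
qed

lemma cos_sin_Ints:
  assumes "i \<in> {0, pi/2, pi}" "t \<in> multiples (if i = 0 then 2 * pi else i)"
  shows "cos t \<in> \<int> \<and> sin t \<in> \<int>"
proof -
  have "\<exists>n::int. t = of_int n * (pi/2)"
  proof -
    obtain m where m: "t = (if i = 0 then 2 * pi else i) * of_int m"
      using assms(2) by (auto simp: multiples_def)
    have "t = of_int (4 * m) * (pi/2) \<or> t = of_int m * (pi/2) \<or> t = of_int (2 * m) * (pi/2)"
      using assms(1) m by auto
    then show ?thesis by blast
  qed
  then obtain n :: int where n: "t = of_int n * (pi/2)" by blast
  have "2 * t = of_int n * pi" using n by simp
  then have "sin (2 * t) = 0" using sin_zero_iff_int2 by blast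
  then have "sin t = 0 \<or> cos t = 0" by (simp add: sin_double)
  then have "sin t = 0 \<and> (cos t)\<^sup>2 = 1 \<or> cos t = 0 \<and> (sin t)\<^sup>2 = 1"
    using sin_cos_squared_add[of t] by fastforce
  then show ?thesis by (auto simp: power2_eq_1_iff)
qed

lemma subgroup_Lambda:
  assumes "k > 0" "i \<in> {0, pi/2, pi}"
  shows "subgroup (Lambda k i) oscillator_group"
proof
  show "Lambda k i \<subseteq> carrier oscillator_group" by (simp add: oscillator_group_def)
  show "\<one>\<^bsub>oscillator_group\<^esub> \<in> Lambda k i"
    by (auto simp: oscillator_group_def Lambda_def Gamma_def multiples_def)
next
  fix a b assume ab: "a \<in> Lambda k i" "b \<in> Lambda k i"
  obtain t x y z t' x' y' z' where a: "a = (t, x, y, z)" and b: "b = (t', x', y', z')"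
    by (metis prod.exhaust)
  define u v where "u = x' * cos t + y' * sin t" and "v = - x' * sin t + y' * cos t"
  have "cos t \<in> \<int>" "sin t \<in> \<int>" and xy: "x \<in> \<int>" "y \<in> \<int>" "x' \<in> \<int>" "y' \<in> \<int>"
    using ab cos_sin_Ints[OF assms(2)] by (simp_all add: a b Lambda_def Gamma_def)
  then have uv: "u \<in> \<int>" "v \<in> \<int>" by (simp_all add: u_def v_def)
  have "1/2 * (x * v - u * y) \<in> multiples (1 / (2 * real k))"
    using xy uv by (intro half_Int_in_multiples[OF assms(1)]) simp
  then have "(t + t', x + u, y + v, z + z' + 1/2 * (x * v - u * y)) \<in> Lambda k i"
    using ab xy uv unfolding a b Lambda_def Gamma_def mem_Times_iff fst_conv snd_conv
    by (intro conjI multiples_add Ints_add) blast+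
  then show "a \<otimes>\<^bsub>oscillator_group\<^esub> b \<in> Lambda k i"
    by (simp only: oscillator_group_def monoid.simps osc_mult.simps a b Let_def u_def v_def)
next
  fix a assume "a \<in> Lambda k i"
  then show "inv\<^bsub>oscillator_group\<^esub> a \<in> Lambda k i"
    unfolding inv_oscillator_group using cos_sin_Ints[OF assms(2)]
    by (auto simp: osc_inv_def Lambda_def Gamma_def intro!: multiples_uminus)
qed

lemma group_Lambda_group:
  assumes "k > 0" "i \<in> {0, pi/2, pi}"
  shows "group (Lambda_group k i)"
  unfolding Lambda_group_def
  by (rule subgroup.subgroup_is_group[OF subgroup_Lambda[OF assms] group_oscillator_group])

end

theory Submission imports Defs begin

text \<open>
  Let \<open>s \<in> {1, 2, 4}\<close> be the order of the rotation by which the generator of the time lattice acts.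
  Every \<open>s\<close>-th power acts trivially on the plane and has both plane coordinates in \<open>s\<int>\<close>, so the
  commutators of \<open>s\<close>-th powers are the central elements \<open>(0, 0, 0, s\<^sup>2 d)\<close> with \<open>d \<in> \<int>\<close>. All of
  them have a central \<open>n\<close>-th root exactly when \<open>n\<close> divides \<open>2ks\<^sup>2\<close>, whereas the commutators of
  \<open>q\<close>-th powers are not even all central unless \<open>s\<close> divides \<open>q\<close>. Hence both \<open>s\<close> and \<open>k\<close> are
  invariants of the group.
\<close>

section \<open>An isomorphism-invariant property of commutators of powers\<close>

text \<open>The last equation says that \<open>c\<close> to the power \<open>n\<close> is the
  commutator of \<open>a\<close> and \<open>b\<close>, both raised to the power \<open>q\<close>.
  Clearing the inverses leaves only products and powers to transport along an isomorphism.\<close>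

definition commutators_have_central_roots :: "('a, 'b) monoid_scheme \<Rightarrow> nat \<Rightarrow> nat \<Rightarrow> bool" where
  "commutators_have_central_roots G q n \<longleftrightarrow>
     (\<forall>a\<in>carrier G. \<forall>b\<in>carrier G. \<exists>c\<in>carrier G.
        (\<forall>d\<in>carrier G. c \<otimes>\<^bsub>G\<^esub> d = d \<otimes>\<^bsub>G\<^esub> c) \<and>
        c [^]\<^bsub>G\<^esub> n \<otimes>\<^bsub>G\<^esub> (b [^]\<^bsub>G\<^esub> q \<otimes>\<^bsub>G\<^esub> a [^]\<^bsub>G\<^esub> q) = a [^]\<^bsub>G\<^esub> q \<otimes>\<^bsub>G\<^esub> b [^]\<^bsub>G\<^esub> q)"

lemma commutators_have_central_roots_iso:
  assumes "group G" "group H" "G \<cong> H" and G: "commutators_have_central_roots G q n"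
  shows "commutators_have_central_roots H q n"
  unfolding commutators_have_central_roots_def
proof (intro ballI)
  interpret G: group G by fact
  interpret H: group H by fact
  obtain h where h: "h \<in> hom G H" and bij: "bij_betw h (carrier G) (carrier H)"
    using assms(3) by (auto simp: is_iso_def iso_def)
  have mult: "h (x \<otimes>\<^bsub>G\<^esub> y) = h x \<otimes>\<^bsub>H\<^esub> h y" if "x \<in> carrier G" "y \<in> carrier G" for x y
    using h that by (rule hom_mult)
  have pow: "h (x [^]\<^bsub>G\<^esub> (m::nat)) = h x [^]\<^bsub>H\<^esub> m" if "x \<in> carrier G" for x m
    using h that G.is_group H.is_group by (simp add: hom_nat_pow)
  have surj: "h ` carrier G = carrier H" using bij by (simp add: bij_betw_def)
  fix a b assume "a \<in> carrier H" "b \<in> carrier H"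
  then obtain x y where x: "x \<in> carrier G" "a = h x" and y: "y \<in> carrier G" "b = h y"
    using surj by blast
  then obtain c where c: "c \<in> carrier G" "\<And>d. d \<in> carrier G \<Longrightarrow> c \<otimes>\<^bsub>G\<^esub> d = d \<otimes>\<^bsub>G\<^esub> c"
    and eq: "c [^]\<^bsub>G\<^esub> n \<otimes>\<^bsub>G\<^esub> (y [^]\<^bsub>G\<^esub> q \<otimes>\<^bsub>G\<^esub> x [^]\<^bsub>G\<^esub> q) = x [^]\<^bsub>G\<^esub> q \<otimes>\<^bsub>G\<^esub> y [^]\<^bsub>G\<^esub> q"
    using G by (force simp: commutators_have_central_roots_def)
  show "\<exists>c\<in>carrier H. (\<forall>d\<in>carrier H. c \<otimes>\<^bsub>H\<^esub> d = d \<otimes>\<^bsub>H\<^esub> c) \<and>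
      c [^]\<^bsub>H\<^esub> n \<otimes>\<^bsub>H\<^esub> (b [^]\<^bsub>H\<^esub> q \<otimes>\<^bsub>H\<^esub> a [^]\<^bsub>H\<^esub> q) = a [^]\<^bsub>H\<^esub> q \<otimes>\<^bsub>H\<^esub> b [^]\<^bsub>H\<^esub> q"
  proof (intro bexI[of _ "h c"] conjI ballI)
    fix d assume "d \<in> carrier H"
    then obtain e where "e \<in> carrier G" "d = h e" using surj by blast
    then show "h c \<otimes>\<^bsub>H\<^esub> d = d \<otimes>\<^bsub>H\<^esub> h c" using c by (simp flip: mult)
  next
    show "h c [^]\<^bsub>H\<^esub> n \<otimes>\<^bsub>H\<^esub> (b [^]\<^bsub>H\<^esub> q \<otimes>\<^bsub>H\<^esub> a [^]\<^bsub>H\<^esub> q) = a [^]\<^bsub>H\<^esub> q \<otimes>\<^bsub>H\<^esub> b [^]\<^bsub>H\<^esub> q"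
      using arg_cong[OF eq, of h] c(1) x y by (simp add: mult pow)
    show "h c \<in> carrier H" using c(1) surj by blast
  qed
qed

section \<open>Powers in the lattices\<close>

definition rotation_order :: "real \<Rightarrow> nat" where
  "rotation_order i = (if i = 0 then 1 else if i = pi then 2 else 4)"

lemma rotation_order_pos: "rotation_order i > 0"
  by (simp add: rotation_order_def)

lemma time_lattice_eq:
  assumes "i \<in> {0, pi/2, pi}"
  shows "multiples (if i = 0 then 2 * pi else i) = multiples (2 * pi / rotation_order i)"
proof -
  have "(if i = 0 then 2 * pi else i) = 2 * pi / rotation_order i"
    using assms by (elim insertE) (simp_all add: rotation_order_def)
  then show ?thesis by simp
qed

lemma mem_Lambda_iff:
  assumes "i \<in> {0, pi/2, pi}"
  shows "(t, x, y, z) \<in> Lambda k i \<longleftrightarrow>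
    t \<in> multiples (2 * pi / rotation_order i) \<and> x \<in> \<int> \<and> y \<in> \<int> \<and> z \<in> multiples (1 / (2 * real k))"
  by (simp add: Lambda_def Gamma_def time_lattice_eq[OF assms])

lemma zero_in_multiples: "0 \<in> multiples c"
  unfolding multiples_def by (rule range_eqI[of _ _ 0]) simp

lemma Lambda_group_simps [simp]:
  "carrier (Lambda_group k i) = Lambda k i"
  "a \<otimes>\<^bsub>Lambda_group k i\<^esub> b = osc_mult a b"
  "\<one>\<^bsub>Lambda_group k i\<^esub> = (0, 0, 0, 0)"
  by (simp_all add: Lambda_group_def oscillator_group_def)

lemma Lambda_group_pow_0: "a [^]\<^bsub>Lambda_group k i\<^esub> (0::nat) = (0, 0, 0, 0)"
  by (simp add: nat_pow_def)

lemma Lambda_group_pow_Suc: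
  "a [^]\<^bsub>Lambda_group k i\<^esub> Suc n = osc_mult (a [^]\<^bsub>Lambda_group k i\<^esub> n) a"
  by (simp add: nat_pow_def)

text \<open>Only the time of the left factor rotates. Splitting off \<open>a\<close> on the left
  thus keeps the angle at the time of \<open>a\<close>, while \<open>Lambda_group_pow_Suc\<close>
  rotates by its \<open>n\<close>-fold multiple.\<close>

lemma Lambda_group_pow_Suc2:
  "a [^]\<^bsub>Lambda_group k i\<^esub> Suc n = osc_mult a (a [^]\<^bsub>Lambda_group k i\<^esub> n)"
proof (induction n)
  case 0
  then show ?case by (cases a) (simp add: Lambda_group_pow_0 Lambda_group_pow_Suc Let_def)
next
  case (Suc n)
  then show ?case by (metis Lambda_group_pow_Suc osc_mult_assoc)
qed

lemma fst_osc_mult: "fst (osc_mult a b) = fst a + fst b"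
  by (cases a; cases b) (simp add: Let_def)

lemma fst_Lambda_group_pow: "fst (a [^]\<^bsub>Lambda_group k i\<^esub> (n::nat)) = n * fst a"
  by (induction n) (simp_all add: Lambda_group_pow_0 Lambda_group_pow_Suc fst_osc_mult algebra_simps)

lemma Lambda_group_pow_translation:
  "(0, x, y, z) [^]\<^bsub>Lambda_group k i\<^esub> (n::nat) = (0, n * x, n * y, n * z)"
  by (induction n) (simp_all add: Lambda_group_pow_0 Lambda_group_pow_Suc algebra_simps)

lemma Lambda_group_pow_vertical:
  "(t, 0, 0, 0) [^]\<^bsub>Lambda_group k i\<^esub> (n::nat) = (n * t, 0, 0, 0)"
  by (induction n) (simp_all add: Lambda_group_pow_0 Lambda_group_pow_Suc algebra_simps)

text \<open>A half turn forces \<open>s = rotation_order i\<close> to be even and a quarter turn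
  forces \<open>s = 4\<close>. Hence the first \<open>s\<close> powers of any nontrivial rotation
  that occurs sum to zero.\<close>

lemma cos_sin_quarter_turns:
  assumes "t = 2 * pi / rotation_order i * of_int m"
  shows "(cos t, sin t) = (1, 0) \<or>
    even (rotation_order i) \<and> (cos t, sin t) = (-1, 0) \<or>
    rotation_order i = 4 \<and> (cos t, sin t) \<in> {(0, 1), (0, -1)}"
proof -
  consider "rotation_order i = 1" | "rotation_order i = 2" | "rotation_order i = 4"
    by (metis rotation_order_def)
  then show ?thesis
  proof cases
    case 1
    then show ?thesis using assms by simp
  next
    case 2
    then have "sin t = 0" using assms sin_zero_iff_int2[of t] by (auto simp: mult.commute)
    moreover from this have "(cos t)\<^sup>2 = 1" using sin_cos_squared_add[of t] by simp
    ultimately show ?thesis using 2 by (auto simp: power2_eq_1_iff)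
  next
    case 3
    have "sin (2 * t) = 0" using assms 3 sin_zero_iff_int2[of "2 * t"] by (auto simp: mult.commute)
    then have "sin t = 0 \<or> cos t = 0" by (simp add: sin_double)
    then have "sin t = 0 \<and> (cos t)\<^sup>2 = 1 \<or> cos t = 0 \<and> (sin t)\<^sup>2 = 1"
      using sin_cos_squared_add[of t] by fastforce
    then show ?thesis using 3 by (auto simp: power2_eq_1_iff)
  qed
qed

text \<open>The plane part of the power is \<open>(1 + R + \<dots> + R\<^bsup>s-1\<^esup>)(x, y)\<close> for a rotation \<open>R\<close> with
  \<open>R\<^bsup>s\<^esup> = 1\<close>, hence \<open>s(x, y)\<close> if \<open>R = 1\<close> and \<open>0\<close> otherwise.\<close>

lemma Lambda_group_pow_rotation_order:
  assumes "i \<in> {0, pi/2, pi}" "a \<in> Lambda k i"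
  obtains m X Y :: int and z where
    "a [^]\<^bsub>Lambda_group k i\<^esub> rotation_order i =
      (2 * pi * m, rotation_order i * X, rotation_order i * Y, z)"
proof -
  let ?s = "rotation_order i"
  obtain t x y w where a: "a = (t, x, y, w)" by (metis prod.exhaust)
  obtain m :: int where m: "t = 2 * pi / ?s * m"
    using assms by (auto simp: a mem_Lambda_iff multiples_def)
  obtain x' y' :: int where xy: "x = x'" "y = y'"
    using assms by (auto simp: a mem_Lambda_iff elim!: Ints_cases)
  have s: "?s = Suc 0 \<or> ?s = Suc (Suc 0) \<or> ?s = Suc (Suc (Suc (Suc 0)))"
    by (simp add: rotation_order_def)
  have plane: "fst (snd (a [^]\<^bsub>Lambda_group k i\<^esub> ?s)) = ?s * x \<and>
      fst (snd (snd (a [^]\<^bsub>Lambda_group k i\<^esub> ?s))) = ?s * y \<or>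
      fst (snd (a [^]\<^bsub>Lambda_group k i\<^esub> ?s)) = 0 \<and>
      fst (snd (snd (a [^]\<^bsub>Lambda_group k i\<^esub> ?s))) = 0"
    using s cos_sin_quarter_turns[OF m]
    by (simp only: prod.inject insert_iff empty_iff simp_thms, elim disjE)
      (simp_all only: a Lambda_group_pow_0 Lambda_group_pow_Suc2 osc_mult.simps Let_def
        fst_conv snd_conv, auto)
  have "fst (a [^]\<^bsub>Lambda_group k i\<^esub> ?s) = 2 * pi * m"
    using rotation_order_pos[of i] by (simp add: fst_Lambda_group_pow a m)
  with plane that[of m x' y'] that[of m 0 0] show thesis
    by (cases "a [^]\<^bsub>Lambda_group k i\<^esub> ?s") (auto simp: xy)
qed

section \<open>Parameters for which the lattices have the property\<close>

lemma commutators_have_central_roots_Lambda: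
  assumes "i \<in> {0, pi/2, pi}" "k > 0"
  shows "commutators_have_central_roots (Lambda_group k i) (rotation_order i) (2 * k * (rotation_order i)\<^sup>2)"
  unfolding commutators_have_central_roots_def Lambda_group_simps
proof (intro ballI)
  let ?s = "rotation_order i" and ?G = "Lambda_group k i"
  fix a b assume ab: "a \<in> Lambda k i" "b \<in> Lambda k i"
  obtain m X Y :: int and z where a: "a [^]\<^bsub>?G\<^esub> ?s = (2 * pi * m, ?s * X, ?s * Y, z)"
    using Lambda_group_pow_rotation_order[OF assms(1) ab(1)] .
  obtain m' X' Y' :: int and z' where b: "b [^]\<^bsub>?G\<^esub> ?s = (2 * pi * m', ?s * X', ?s * Y', z')"
    using Lambda_group_pow_rotation_order[OF assms(1) ab(2)] .
  \<comment> \<open>Times in \<open>2 * pi * \<int>\<close> rotate trivially, so the commutator has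
    central coordinate \<open>?s\<^sup>2 * (X * Y' - X' * Y)\<close>. Dividing it by the exponent
    \<open>2 * k * ?s\<^sup>2\<close> gives this root.\<close>
  define c :: real4 where "c = (0, 0, 0, 1 / (2 * real k) * of_int (X * Y' - X' * Y))"
  have "c \<in> Lambda k i"
    unfolding c_def mem_Lambda_iff[OF assms(1)]
    by (intro conjI zero_in_multiples) (simp_all only: multiples_def Ints_0, rule rangeI)
  moreover have "osc_mult c d = osc_mult d c" for d
    by (cases d) (simp add: c_def)
  moreover have "osc_mult (c [^]\<^bsub>?G\<^esub> (2 * k * ?s\<^sup>2)) (osc_mult (b [^]\<^bsub>?G\<^esub> ?s) (a [^]\<^bsub>?G\<^esub> ?s)) =
      osc_mult (a [^]\<^bsub>?G\<^esub> ?s) (b [^]\<^bsub>?G\<^esub> ?s)"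
    using assms(2)
    by (simp add: a b c_def Lambda_group_pow_translation power2_eq_square) (simp add: field_simps)
  ultimately show "\<exists>c\<in>Lambda k i. (\<forall>d\<in>Lambda k i. osc_mult c d = osc_mult d c) \<and>
      osc_mult (c [^]\<^bsub>?G\<^esub> (2 * k * ?s\<^sup>2)) (osc_mult (b [^]\<^bsub>?G\<^esub> ?s) (a [^]\<^bsub>?G\<^esub> ?s)) =
      osc_mult (a [^]\<^bsub>?G\<^esub> ?s) (b [^]\<^bsub>?G\<^esub> ?s)"
    by blast
qed

text \<open>Test elements are a generator of the time lattice and a unit translation. If the time
  generator rotates nontrivially, a central \<open>c\<close> has no plane part to compensate for the
  rotation of the translation by \<open>q * \<tau>\<close>, so that rotation must be
  trivial.\<close>

lemma rotation_order_dvd_if_central_roots: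
  assumes i: "i \<in> {0, pi/2, pi}" and "q > 0" "n > 0"
    and roots: "commutators_have_central_roots (Lambda_group k i) q n"
  shows "rotation_order i dvd q"
proof -
  let ?s = "rotation_order i" and ?G = "Lambda_group k i"
  define \<tau> where "\<tau> = 2 * pi / ?s"
  define a b :: real4 where "a = (\<tau>, 0, 0, 0)" and "b = (0, 1, 0, 0)"
  have "\<tau> \<in> multiples \<tau>" unfolding multiples_def by (rule range_eqI[of _ _ 1]) simp
  then have a: "a \<in> Lambda k i" and b: "b \<in> Lambda k i"
    using i by (simp_all add: a_def b_def mem_Lambda_iff zero_in_multiples \<tau>_def)
  then obtain c where central: "osc_mult c a = osc_mult a c"
    and eq: "osc_mult (c [^]\<^bsub>?G\<^esub> n) (osc_mult (b [^]\<^bsub>?G\<^esub> q) (a [^]\<^bsub>?G\<^esub> q)) =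
      osc_mult (a [^]\<^bsub>?G\<^esub> q) (b [^]\<^bsub>?G\<^esub> q)"
    using roots by (fastforce simp: commutators_have_central_roots_def)
  obtain t x y z where c: "c = (t, x, y, z)" by (metis prod.exhaust)
  have "t = 0" using arg_cong[OF eq, of fst] \<open>n > 0\<close>
    by (simp add: fst_osc_mult fst_Lambda_group_pow c)
  have rot: "x * cos \<tau> + y * sin \<tau> = x" "- x * sin \<tau> + y * cos \<tau> = y"
    using central by (simp_all add: a_def c Let_def)
  have "cos (q * \<tau>) = 1"
  proof (cases "cos \<tau> = 1")
    case True
    then obtain m :: int where "\<tau> = of_int m * 2 * pi" using cos_one_2pi_int by blast
    then have "q * \<tau> = 2 * pi * of_int (int q * m)" by simp
    then show ?thesis by (simp only: cos_int_2pin)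
  next
    case False
    \<comment> \<open>Cramer's rule: \<open>2 * (1 - cos \<tau>)\<close> is the determinant of the
      identity minus the rotation, and \<open>rot\<close> puts \<open>(x, y)\<close> in the kernel
      of that map.\<close>
    have "2 * (1 - cos \<tau>) * x = ((1 - cos \<tau>)\<^sup>2 + (sin \<tau>)\<^sup>2) * x"
      using sin_cos_squared_add[of \<tau>] by (simp add: power2_diff)
    also have "\<dots> = (1 - cos \<tau>) * (x - (x * cos \<tau> + y * sin \<tau>))
        + sin \<tau> * (y - (- x * sin \<tau> + y * cos \<tau>))"
      by (simp add: power2_eq_square algebra_simps del: sin_cos_squared_add3)
    also have "\<dots> = 0" unfolding rot by simp
    finally have "x = 0" using False by simp
    then show ?thesis
      \<comment> \<open>With \<open>x = 0\<close>, the first plane coordinate is \<open>q\<close> on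
        the left of \<open>eq\<close> and \<open>q * cos (q * \<tau>)\<close> on the right.\<close>
      using eq \<open>q > 0\<close>
      by (simp add: a_def b_def c \<open>t = 0\<close> Lambda_group_pow_translation
          Lambda_group_pow_vertical Let_def)
  qed
  then obtain m :: int where "q * \<tau> = of_int m * 2 * pi" using cos_one_2pi_int by blast
  then have "real q = of_int (m * int ?s)"
    using rotation_order_pos[of i] by (simp add: \<tau>_def field_simps)
  then have "int q = m * int ?s" by (metis of_int_eq_iff of_int_of_nat_eq)
  then show ?thesis by (metis dvd_triv_right int_dvd_int_iff)
qed

text \<open>The \<open>q\<close>-th powers of the two unit translations have a commutator with
  central coordinate \<open>q\<^sup>2\<close>. An \<open>n\<close>-th root of it has central
  coordinate \<open>r / (2 * k)\<close> with \<open>r\<close> an integer, so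
  \<open>n * r = 2 * k * q\<^sup>2\<close>.\<close>

lemma root_exponent_dvd_if_central_roots:
  assumes i: "i \<in> {0, pi/2, pi}" and "k > 0" "n > 0"
    and roots: "commutators_have_central_roots (Lambda_group k i) q n"
  shows "n dvd 2 * k * q\<^sup>2"
proof -
  let ?G = "Lambda_group k i"
  define a b :: real4 where "a = (0, 1, 0, 0)" and "b = (0, 0, 1, 0)"
  have a: "a \<in> Lambda k i" and b: "b \<in> Lambda k i"
    using i by (simp_all add: a_def b_def mem_Lambda_iff zero_in_multiples)
  then obtain c where "c \<in> Lambda k i"
    and eq: "osc_mult (c [^]\<^bsub>?G\<^esub> n) (osc_mult (b [^]\<^bsub>?G\<^esub> q) (a [^]\<^bsub>?G\<^esub> q)) =
      osc_mult (a [^]\<^bsub>?G\<^esub> q) (b [^]\<^bsub>?G\<^esub> q)"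
    using roots by (fastforce simp: commutators_have_central_roots_def)
  obtain t x y z where c: "c = (t, x, y, z)" by (metis prod.exhaust)
  obtain r :: int where r: "z = 1 / (2 * real k) * r"
    using \<open>c \<in> Lambda k i\<close> i by (auto simp: c mem_Lambda_iff multiples_def)
  have "t = 0" using arg_cong[OF eq, of fst] \<open>n > 0\<close>
    by (simp add: fst_osc_mult fst_Lambda_group_pow c)
  \<comment> \<open>The plane coordinates of \<open>eq\<close> force \<open>x = y = 0\<close>, which
    removes the mixed terms from the central coordinate.\<close>
  then have "n * z = (real q)\<^sup>2"
    using eq \<open>n > 0\<close>
    by (simp add: a_def b_def c Lambda_group_pow_translation power2_eq_square Let_def) auto
  then have "real_of_int (int n * r) = real_of_int (int (2 * k * q\<^sup>2))"
    using \<open>k > 0\<close> by (simp add: r field_simps)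
  then have "int n * r = int (2 * k * q\<^sup>2)" by (simp only: of_int_eq_iff)
  then show ?thesis by (metis dvd_triv_left int_dvd_int_iff)
qed

theorem proposition2p3:
  fixes k p :: nat and i j :: real
  assumes "k > 0" and "p > 0"
    and "i \<in> {0, pi/2, pi}" and "j \<in> {0, pi/2, pi}"
    and "(k, i) \<noteq> (p, j)"
  shows "\<not> (Lambda_group k i \<cong> Lambda_group p j)"
proof
  \<comment> \<open>Stated for arbitrary indices so that it applies to the isomorphism and to its
    inverse.\<close>
  have dvd: "rotation_order j dvd rotation_order i \<and>
      2 * k * (rotation_order i)\<^sup>2 dvd 2 * p * (rotation_order i)\<^sup>2"
    if "k > 0" "p > 0" "i \<in> {0, pi/2, pi}" "j \<in> {0, pi/2, pi}"
      and iso: "Lambda_group k i \<cong> Lambda_group p j" for k p :: nat and i j :: real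
  proof -
    have "commutators_have_central_roots (Lambda_group p j) (rotation_order i)
        (2 * k * (rotation_order i)\<^sup>2)"
      using group_Lambda_group group_Lambda_group iso commutators_have_central_roots_Lambda
      by (rule commutators_have_central_roots_iso) (use that in simp_all)
    then show ?thesis
      using that(1-4) rotation_order_pos[of i]
      by (intro conjI rotation_order_dvd_if_central_roots root_exponent_dvd_if_central_roots) simp_all
  qed
  assume iso: "Lambda_group k i \<cong> Lambda_group p j"
  then have iso': "Lambda_group p j \<cong> Lambda_group k i"
    using group.iso_sym[OF group_Lambda_group] assms by blast
  have order: "rotation_order i = rotation_order j"
    using dvd[OF _ _ _ _ iso] dvd[OF _ _ _ _ iso'] assms by (auto intro: dvd_antisym)
  then have "i = j" using assms by (auto simp: rotation_order_def split: if_splits)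
  \<comment> \<open>The reverse divisibility carries the factor
    \<open>(rotation_order j)\<^sup>2\<close>; by \<open>order\<close> it concerns the same two
    numbers.\<close>
  have "2 * k * (rotation_order i)\<^sup>2 = 2 * p * (rotation_order i)\<^sup>2"
    using dvd[OF _ _ _ _ iso] dvd[OF _ _ _ _ iso'] assms order by (auto intro: dvd_antisym)
  then have "k = p" using rotation_order_pos[of i] by simp
  with \<open>i = j\<close> assms(5) show False by simp
qed

end
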